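(* Let $\mathcal M$ be a set of $N$ men and $\mathcal W$ a set of $N$ women, let $P:\mathcal M\times\mathcal W\to\mathbb R_{>0}$, and let the preference profile be sampled from the symmetric anti-popularity preference distribution defined by $P$. Let $\mu:\mathcal M\cup\mathcal W\to\mathcal M\cup\mathcal W$ be a fixed matching. Then $$\mathbb P[\mu\text{ is stable and women-optimal}]=\sum_{\substack{\sigma\text{ permutation}\\ \sigma|_{\mathcal M}=\mu|_{\mathcal M}}}(-1)^{C(\sigma)}\,\mathbb P[\sigma\text{ is stable}],$$ $$\mathbb P[\mu\text{ is stable and men-optimal}]=\sum_{\substack{\sigma\text{ permutation}\\ \sigma|_{\mathcal W}=\mu|_{\mathcal W}}}(-1)^{C(\sigma)}\,\mathbb P[\sigma\text{ is stable}],$$ where $C(\sigma)$ is the number of cycles of length $>2$ of $\sigma$.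
   Context: A preference profile gives each man $m$ a strict total order $\succ_m$ over $\mathcal W$ and each woman $w$ a strict total order $\succ_w$ over $\mathcal M$. Symmetric anti-popularity preference distribution defined by $P$: the preference lists of all $2N$ agents are mutually independent. Each man $m$ builds his list from the end, by sampling without replacement from the distribution on $\mathcal W$ that gives woman $w$ probability proportional to $1/P(m,w)$: he first samples his least preferred woman, then his second least preferred, and so on up to his favourite (at each step a woman $w$ not yet sampled is chosen with probability $1/P(m,w)$ divided by the sum of $1/P(m,w')$ over the women $w'$ not yet sampled). Symmetrically, each woman $w$ builds her list from the end, by sampling without replacement from the distribution on $\mathcal M$ that gives man $m$ probability proportional to $1/P(m,w)$. A matching is an involution $\mu$ of $\mathcal M\cup\mathcal W$ with $\mu(\mathcal M)\subseteq\mathcal W$ and $\mu(\mathcal W)\subseteq\mathcal M$. It is stable if for all $m\in\mathcal M$, $w\in\mathcal W$, $\mu(m)\succeq_m w$ or $\mu(w)\succeq_w m$. A stable matching $\mu$ is women-optimal if $\mu(w)\succeq_w\mu'(w)$ for every $w\in\mathcal W$ and every stable matching $\mu'$, and men-optimal if $\mu(m)\succeq_m\mu'(m)$ for every $m\in\mathcal M$ and every stable matching $\mu'$. A permutation here means a bijection $\sigma$ of $\mathcal M\cup\mathcal W$ with $\sigma(\mathcal M)\subseteq\mathcal W$ and $\sigma(\mathcal W)\subseteq\mathcal M$. Given a preference profile, $\sigma$ is stable if (i) $\sigma(x)\succeq_x\sigma^{-1}(x)$ for every $x\in\mathcal M\cup\mathcal W$, and (ii) there is no pair $(m,w)\in\mathcal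 M\times\mathcal W$ with both $w\succ_m\sigma^{-1}(m)$ and $m\succ_w\sigma^{-1}(w)$. *)

theory Defs
  imports "HOL-Probability.Probability" "HOL-Combinatorics.Orbits"
begin

text \<open>
  Men and women are disjoint finite sets \<open>M\<close> and \<open>W\<close> of agents of one type. A preference profile
  maps an agent \<open>x\<close> to its strict preference relation; \<open>(a, b) \<in> R x\<close> means that \<open>x\<close> strictly
  prefers \<open>a\<close> to \<open>b\<close>.
\<close>

type_synonym 'a profile = "'a \<Rightarrow> 'a rel"

definition preference_profile :: "'a set \<Rightarrow> 'a set \<Rightarrow> 'a profile \<Rightarrow> bool" where
  "preference_profile M W R \<longleftrightarrow>
     (\<forall>m\<in>M. R m \<subseteq> W \<times> W \<and> strict_linear_order_on W (R m)) \<and>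
     (\<forall>w\<in>W. R w \<subseteq> M \<times> M \<and> strict_linear_order_on M (R w))"

definition weakly_prefers :: "'a profile \<Rightarrow> 'a \<Rightarrow> 'a \<Rightarrow> 'a \<Rightarrow> bool" where
  "weakly_prefers R x a b \<longleftrightarrow> a = b \<or> (a, b) \<in> R x"


definition weighted_pmf :: "'a set \<Rightarrow> ('a \<Rightarrow> real) \<Rightarrow> 'a pmf" where
  "weighted_pmf A f = embed_pmf (\<lambda>x. if x \<in> A then f x / (\<Sum>y\<in>A. f y) else 0)"

text \<open>\<open>embed_pmf\<close> is only meaningful under the following side conditions.\<close>

lemma pmf_weighted_pmf:
  assumes "finite A" "A \<noteq> {}" "\<And>x. x \<in> A \<Longrightarrow> f x > 0"
  shows "pmf (weighted_pmf A f) x = (if x \<in> A then f x / (\<Sum>y\<in>A. f y) else 0)"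
proof -
  have pos: "(\<Sum>y\<in>A. f y) > 0"
    using assms by (intro sum_pos) auto
  have nonneg: "0 \<le> (if x \<in> A then f x / (\<Sum>y\<in>A. f y) else 0)" for x
    using pos assms(3)[of x] by auto
  have "(\<integral>\<^sup>+x. ennreal (if x \<in> A then f x / (\<Sum>y\<in>A. f y) else 0) \<partial>count_space UNIV) =
        (\<Sum>x\<in>A. ennreal (f x / (\<Sum>y\<in>A. f y)))"
    using assms(1) by (subst nn_integral_count_space'[where A = A]) auto
  also have "\<dots> = ennreal (\<Sum>x\<in>A. f x / (\<Sum>y\<in>A. f y))"
    using pos assms(3) by (intro sum_ennreal) (auto intro!: divide_nonneg_pos less_imp_le)
  also have "(\<Sum>x\<in>A. f x / (\<Sum>y\<in>A. f y)) = 1"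
    using pos by (simp flip: sum_divide_distrib)
  finally show ?thesis
    unfolding weighted_pmf_def using nonneg by (subst pmf_embed_pmf) auto
qed

lemma set_weighted_pmf:
  assumes "finite A" "A \<noteq> {}" "\<And>x. x \<in> A \<Longrightarrow> f x > 0"
  shows "set_pmf (weighted_pmf A f) \<subseteq> A"
  using assms by (auto simp: set_pmf_eq pmf_weighted_pmf split: if_splits)

text \<open>
  Preference lists are written from the favourite to the least preferred candidate, so each
  sampled element is ranked below everything sampled after it.
\<close>

primrec anti_popularity_list_pmf :: "nat \<Rightarrow> 'a set \<Rightarrow> ('a \<Rightarrow> real) \<Rightarrow> 'a list pmf" where
  "anti_popularity_list_pmf 0 A p = return_pmf []"
| "anti_popularity_list_pmf (Suc n) A p =
     bind_pmf (weighted_pmf A (\<lambda>x. 1 / p x)) (\<lambda>x.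
       map_pmf (\<lambda>xs. xs @ [x]) (anti_popularity_list_pmf n (A - {x}) p))"

definition order_of_list :: "'a list \<Rightarrow> 'a rel" where
  "order_of_list xs = {(xs ! i, xs ! j) | i j. i < j \<and> j < length xs}"

definition anti_popularity_order_pmf :: "'a set \<Rightarrow> ('a \<Rightarrow> real) \<Rightarrow> 'a rel pmf" where
  "anti_popularity_order_pmf A p =
     map_pmf order_of_list (anti_popularity_list_pmf (card A) A p)"

definition symmetric_anti_popularity_pmf ::
  "'a set \<Rightarrow> 'a set \<Rightarrow> ('a \<Rightarrow> 'a \<Rightarrow> real) \<Rightarrow> 'a profile pmf" where
  "symmetric_anti_popularity_pmf M W P =
     Pi_pmf (M \<union> W) {} (\<lambda>x.
       if x \<in> M then anti_popularity_order_pmf W (\<lambda>w. P x w)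
       else anti_popularity_order_pmf M (\<lambda>m. P m x))"

lemma set_anti_popularity_list_pmf:
  assumes "finite A" "card A = n" "\<And>x. x \<in> A \<Longrightarrow> p x > 0"
    and "xs \<in> set_pmf (anti_popularity_list_pmf n A p)"
  shows "distinct xs \<and> set xs = A"
  using assms
proof (induction n arbitrary: A xs)
  case 0
  then show ?case by simp
next
  case (Suc n)
  have "A \<noteq> {}" using Suc.prems(2) by auto
  then have sub: "set_pmf (weighted_pmf A (\<lambda>x. 1 / p x)) \<subseteq> A"
    using Suc.prems(1,3) by (intro set_weighted_pmf) auto
  from Suc.prems(4) obtain x ys where x: "x \<in> set_pmf (weighted_pmf A (\<lambda>x. 1 / p x))"
    and ys: "ys \<in> set_pmf (anti_popularity_list_pmf n (A - {x}) p)" and xs: "xs = ys @ [x]"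
    by auto
  have "distinct ys \<and> set ys = A - {x}"
    using Suc.prems x sub by (intro Suc.IH ys) auto
  then show ?case using xs x sub by auto
qed

lemma order_of_list_strict_linear_order:
  assumes "distinct xs"
  shows "order_of_list xs \<subseteq> set xs \<times> set xs"
    and "strict_linear_order_on (set xs) (order_of_list xs)"
proof -
  show "order_of_list xs \<subseteq> set xs \<times> set xs"
    by (auto simp: order_of_list_def)
  have "trans (order_of_list xs)"
  proof (rule transI)
    fix a b c assume "(a, b) \<in> order_of_list xs" "(b, c) \<in> order_of_list xs"
    then obtain i j k l where *: "a = xs ! i" "b = xs ! j" "i < j" "j < length xs"
      "b = xs ! k" "c = xs ! l" "k < l" "l < length xs"
      by (auto simp: order_of_list_def)
    then have "j = k" using assms by (metis nth_eq_iff_index_eq order.strict_trans)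
    then have "i < l" using * by simp
    then show "(a, c) \<in> order_of_list xs"
      using * unfolding order_of_list_def by blast
  qed
  moreover have "irrefl (order_of_list xs)"
    using assms by (auto simp: irrefl_def order_of_list_def nth_eq_iff_index_eq)
  moreover have "total_on (set xs) (order_of_list xs)"
  proof (rule total_onI)
    fix a b assume "a \<in> set xs" "b \<in> set xs" "a \<noteq> b"
    then obtain i j where *: "a = xs ! i" "b = xs ! j" "i < length xs" "j < length xs" "i \<noteq> j"
      by (auto simp: in_set_conv_nth)
    then consider "i < j" | "j < i" by linarith
    then show "(a, b) \<in> order_of_list xs \<or> (b, a) \<in> order_of_list xs"
      using * unfolding order_of_list_def by cases blast+
  qed
  ultimately show "strict_linear_order_on (set xs) (order_of_list xs)"
    by (simp add: strict_linear_order_on_def)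
qed

lemma set_anti_popularity_order_pmf:
  assumes "finite A" "\<And>x. x \<in> A \<Longrightarrow> p x > 0" "r \<in> set_pmf (anti_popularity_order_pmf A p)"
  shows "r \<subseteq> A \<times> A \<and> strict_linear_order_on A r"
proof -
  from assms(3) obtain xs where xs: "xs \<in> set_pmf (anti_popularity_list_pmf (card A) A p)"
    and r: "r = order_of_list xs"
    by (auto simp: anti_popularity_order_pmf_def)
  have "distinct xs \<and> set xs = A"
    using assms xs by (intro set_anti_popularity_list_pmf) auto
  then show ?thesis using order_of_list_strict_linear_order[of xs] r by auto
qed

lemma symmetric_anti_popularity_preference_profile:
  assumes "finite M" "finite W" "M \<inter> W = {}"
    and "\<And>m w. m \<in> M \<Longrightarrow> w \<in> W \<Longrightarrow> P m w > 0"
    and "R \<in> set_pmf (symmetric_anti_popularity_pmf M W P)"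
  shows "preference_profile M W R"
proof -
  have R: "R x \<in> set_pmf (if x \<in> M then anti_popularity_order_pmf W (\<lambda>w. P x w)
                           else anti_popularity_order_pmf M (\<lambda>m. P m x))" if "x \<in> M \<union> W" for x
    using assms(5) that assms(1,2)
    by (auto simp: symmetric_anti_popularity_pmf_def set_Pi_pmf PiE_dflt_def)
  show ?thesis
    unfolding preference_profile_def
  proof (intro conjI ballI; (elim conjE)?)
    fix m assume m: "m \<in> M"
    show "R m \<subseteq> W \<times> W" "strict_linear_order_on W (R m)"
      using R[of m] m assms(2,4) set_anti_popularity_order_pmf[of W "P m" "R m"] by auto
  next
    fix w assume w: "w \<in> W"
    then have "w \<notin> M" using assms(3) by auto
    then show "R w \<subseteq> M \<times> M" "strict_linear_order_on M (R w)"
      using R[of w] w assms(1,4) set_anti_popularity_order_pmf[of M "\<lambda>m. P m w" "R w"] by auto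
  qed
qed


text \<open>Only the values of a matching on \<open>M \<union> W\<close> matter.\<close>

definition matching :: "'a set \<Rightarrow> 'a set \<Rightarrow> ('a \<Rightarrow> 'a) \<Rightarrow> bool" where
  "matching M W \<mu> \<longleftrightarrow> (\<forall>x\<in>M \<union> W. \<mu> (\<mu> x) = x) \<and> \<mu> ` M \<subseteq> W \<and> \<mu> ` W \<subseteq> M"

definition stable_matching :: "'a set \<Rightarrow> 'a set \<Rightarrow> 'a profile \<Rightarrow> ('a \<Rightarrow> 'a) \<Rightarrow> bool" where
  "stable_matching M W R \<mu> \<longleftrightarrow> matching M W \<mu> \<and>
     (\<forall>m\<in>M. \<forall>w\<in>W. weakly_prefers R m (\<mu> m) w \<or> weakly_prefers R w (\<mu> w) m)"

definition women_optimal :: "'a set \<Rightarrow> 'a set \<Rightarrow> 'a profile \<Rightarrow> ('a \<Rightarrow> 'a) \<Rightarrow> bool" where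
  "women_optimal M W R \<mu> \<longleftrightarrow>
     (\<forall>w\<in>W. \<forall>\<mu>'. stable_matching M W R \<mu>' \<longrightarrow> weakly_prefers R w (\<mu> w) (\<mu>' w))"

definition men_optimal :: "'a set \<Rightarrow> 'a set \<Rightarrow> 'a profile \<Rightarrow> ('a \<Rightarrow> 'a) \<Rightarrow> bool" where
  "men_optimal M W R \<mu> \<longleftrightarrow>
     (\<forall>m\<in>M. \<forall>\<mu>'. stable_matching M W R \<mu>' \<longrightarrow> weakly_prefers R m (\<mu> m) (\<mu>' m))"

text \<open>
  \<open>permutes\<close> makes a bijection of \<open>M \<union> W\<close> the identity elsewhere, so that sums over the following
  set count each bijection once and \<open>inv \<sigma>\<close> is its inverse on \<open>M \<union> W\<close>.
\<close>

definition bipartite_permutations :: "'a set \<Rightarrow> 'a set \<Rightarrow> ('a \<Rightarrow> 'a) set" where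
  "bipartite_permutations M W = {\<sigma>. \<sigma> permutes (M \<union> W) \<and> \<sigma> ` M \<subseteq> W \<and> \<sigma> ` W \<subseteq> M}"

definition stable_permutation :: "'a set \<Rightarrow> 'a set \<Rightarrow> 'a profile \<Rightarrow> ('a \<Rightarrow> 'a) \<Rightarrow> bool" where
  "stable_permutation M W R \<sigma> \<longleftrightarrow>
     (\<forall>x\<in>M \<union> W. weakly_prefers R x (\<sigma> x) (inv \<sigma> x)) \<and>
     \<not> (\<exists>m\<in>M. \<exists>w\<in>W. (w, inv \<sigma> m) \<in> R m \<and> (m, inv \<sigma> w) \<in> R w)"

definition num_long_cycles :: "'a set \<Rightarrow> 'a set \<Rightarrow> ('a \<Rightarrow> 'a) \<Rightarrow> nat" where
  "num_long_cycles M W \<sigma> = card {c \<in> orbit \<sigma> ` (M \<union> W). card c > 2}"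

end

theory Submission
  imports Defs
begin

text \<open>
  The identity already holds for every single profile. Fix one, and call \<open>w\<close> an admirer of \<open>m\<close> if \<open>w\<close>
  prefers \<open>m\<close> to \<open>\<mu> w\<close>. A permutation \<open>\<sigma>\<close> extending \<open>\<mu>\<close> on the men is stable iff \<open>\<mu>\<close> is stable and each
  \<open>inv \<sigma> m\<close> is either \<open>\<mu> m\<close> or the admirer whom \<open>m\<close> likes best. Hence the stable \<open>\<sigma>\<close> correspond to the sets
  of cycles of the partial map sending \<open>m\<close> to the \<open>\<mu>\<close>-partner of his best admirer, each such cycle being one
  long cycle of \<open>\<sigma>\<close>. There is no such cycle if \<open>\<mu>\<close> is women-optimal, so that only \<open>\<sigma> = \<mu>\<close> contributes;
  otherwise there is one, and toggling it is a sign-reversing involution on the stable \<open>\<sigma>\<close>. The second identity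
  follows by exchanging the roles of men and women.
\<close>

section \<open>Periodic points, orbits and a cancellation principle\<close>

text \<open>Pigeonhole: two iterates of a point of the finite set \<open>X\<close> coincide, and the
  earlier one then returns to itself. As \<open>orbit\<close> collects only positive iterates,
  \<open>x \<in> orbit g x\<close> says that \<open>x\<close> is periodic.\<close>

lemma periodic_point_exists:
  assumes "finite X" "X \<noteq> {}" "g ` X \<subseteq> X"
  obtains x where "x \<in> X" "x \<in> orbit g x"
proof -
  obtain y where y: "y \<in> X" using assms(2) by blast
  have in_X: "(g ^^ n) y \<in> X" for n
    using y assms(3) by (induction n) auto
  have "\<not> inj (\<lambda>n. (g ^^ n) y)"
    using in_X finite_subset[of "range (\<lambda>n. (g ^^ n) y)" X] assms(1) finite_imageD infinite_UNIV_nat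
    by blast
  then obtain i j where ij: "(g ^^ i) y = (g ^^ j) y" "i < j"
    unfolding inj_def by (metis linorder_neqE_nat)
  have "(g ^^ (j - i)) ((g ^^ i) y) = (g ^^ i) y"
    using ij by (metis comp_apply funpow_add le_add_diff_inverse2 less_imp_le)
  then have "(g ^^ i) y \<in> orbit g ((g ^^ i) y)"
    using ij(2) unfolding orbit_altdef by (metis (mono_tags, lifting) mem_Collect_eq zero_less_diff)
  then show thesis using that in_X by blast
qed

lemma orbit_involution_subset:
  assumes "f (f x) = x"
  shows "orbit f x \<subseteq> {x, f x}"
proof
  fix y assume "y \<in> orbit f x"
  then show "y \<in> {x, f x}" by induction (use assms in auto)
qed

text \<open>On \<open>A\<close> the map \<open>\<sigma>\<close> is one long cycle, while
  \<open>\<tau>\<close> splits \<open>A\<close> into orbits of size at most 2; elsewhere the orbits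
  agree. So \<open>A\<close> is the only long cycle that distinguishes the two.\<close>

lemma num_long_cycles_merge:
  assumes fin: "finite (M \<union> W)"
    and \<sigma>: "\<sigma> permutes M \<union> W" and \<tau>: "\<tau> permutes M \<union> W"
    and A: "A \<subseteq> M \<union> W" "card A > 2" and cyc: "cyclic_on \<sigma> A"
    and inv: "\<And>x. x \<in> A \<Longrightarrow> \<tau> x \<in> A \<and> \<tau> (\<tau> x) = x"
    and eq: "\<And>x. x \<in> M \<union> W - A \<Longrightarrow> \<sigma> x = \<tau> x"
  shows "num_long_cycles M W \<sigma> = Suc (num_long_cycles M W \<tau>)"
proof -
  let ?long = "\<lambda>\<pi>. {c \<in> orbit \<pi> ` (M \<union> W). card c > 2}"
  have perm: "permutation \<sigma>" "permutation \<tau>"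
    using \<sigma> \<tau> fin permutation_permutes by blast+
  have in_A: "orbit \<sigma> x = A" if "x \<in> A" for x
    using cyc that by (rule orbit_cyclic_eq3)
  have short: "card (orbit \<tau> x) \<le> 2" if "x \<in> A" for x
  proof -
    have "card (orbit \<tau> x) \<le> card {x, \<tau> x}"
      using inv[OF that] by (intro card_mono orbit_involution_subset) auto
    also have "\<dots> \<le> 2" by (simp add: card_insert_if)
    finally show ?thesis .
  qed
  \<comment> \<open>\<open>\<sigma>\<close> also preserves the complement of \<open>A\<close>, so an
    orbit starting there depends only on values where the two maps agree.\<close>
  have outside: "orbit \<sigma> x = orbit \<tau> x" if "x \<in> M \<union> W - A" for x
  proof (rule orbit_cong0[OF that])
    show "\<sigma> \<in> (M \<union> W - A) \<rightarrow> (M \<union> W - A)"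
    proof (rule Pi_I)
      fix y assume y: "y \<in> M \<union> W - A"
      then have "\<sigma> y \<notin> A" using cyclic_on_f_in[OF \<sigma> cyc] by auto
      then show "\<sigma> y \<in> M \<union> W - A" using y permutes_in_image[OF \<sigma>, of y] by blast
    qed
  qed (use eq in auto)
  have "?long \<sigma> = insert A (?long \<tau>)"
  proof (intro equalityI subsetI)
    fix c assume "c \<in> ?long \<sigma>"
    then obtain x where x: "x \<in> M \<union> W" "c = orbit \<sigma> x" "card c > 2" by auto
    then show "c \<in> insert A (?long \<tau>)"
      using in_A outside by (cases "x \<in> A") auto
  next
    fix c assume c: "c \<in> insert A (?long \<tau>)"
    show "c \<in> ?long \<sigma>"
    proof (cases "c = A")
      case True
      obtain x where "x \<in> A" using A(2) by (metis card.empty equals0I not_less_zero)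
      then show ?thesis using True A in_A by blast
    next
      case False
      then obtain x where x: "x \<in> M \<union> W" "c = orbit \<tau> x" "card c > 2" using c by auto
      then have "x \<notin> A" using short[of x] by auto
      then show ?thesis using x outside[of x] by auto
    qed
  qed
  \<comment> \<open>Hence inserting \<open>A\<close> raises the count by exactly one.\<close>
  moreover have "A \<notin> ?long \<tau>"
  proof
    assume "A \<in> ?long \<tau>"
    then obtain x where x: "A = orbit \<tau> x" "card (orbit \<tau> x) > 2" by auto
    then have "x \<in> A" using permutation_self_in_orbit[OF perm(2)] by auto
    then show False using short[of x] x by auto
  qed
  moreover have "finite (?long \<tau>)" using fin by auto
  ultimately show ?thesis by (simp add: num_long_cycles_def)
qed

text \<open>Reindexing by \<open>T\<close> shows that the sum equals its own negative. Fixed points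
  of \<open>T\<close> do no harm, since \<open>h\<close> vanishes at them.\<close>

lemma sum_sign_reversing_involution:
  fixes h :: "'b \<Rightarrow> real"
  assumes "\<And>x. x \<in> S \<Longrightarrow> T x \<in> S" "\<And>x. x \<in> S \<Longrightarrow> T (T x) = x" "\<And>x. x \<in> S \<Longrightarrow> h (T x) = - h x"
  shows "sum h S = 0"
proof -
  have "bij_betw T S S"
    using assms(1,2) by (intro bij_betw_byWitness[where f' = T]) auto
  then have "sum h S = (\<Sum>x\<in>S. h (T x))" by (rule sum.reindex_bij_betw[symmetric])
  also have "\<dots> = - sum h S" by (simp add: assms(3) sum_negf)
  finally show ?thesis by simp
qed

section \<open>A single profile: admirers of a man\<close>

locale market =
  fixes M W :: "'a set" and R :: "'a profile" and \<mu> :: "'a \<Rightarrow> 'a"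
  assumes fin: "finite M" "finite W" and disj: "M \<inter> W = {}"
    and profile: "preference_profile M W R" and matching: "matching M W \<mu>"
begin

definition admirer :: "'a \<Rightarrow> 'a \<Rightarrow> bool" where
  "admirer m w \<longleftrightarrow> w \<in> W \<and> (m, \<mu> w) \<in> R w"

definition top_admirer :: "'a \<Rightarrow> 'a \<Rightarrow> bool" where
  "top_admirer m w \<longleftrightarrow> admirer m w \<and> (\<forall>v. admirer m v \<longrightarrow> v = w \<or> (w, v) \<in> R m)"

definition extensions :: "('a \<Rightarrow> 'a) set" where
  "extensions = {\<sigma>. \<sigma> \<in> bipartite_permutations M W \<and> (\<forall>m\<in>M. \<sigma> m = \<mu> m)}"

lemma asym: "x \<in> M \<union> W \<Longrightarrow> (a, b) \<in> R x \<Longrightarrow> (b, a) \<notin> R x"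
  using profile unfolding preference_profile_def strict_linear_order_on_def trans_def irrefl_def
  by blast

lemma irrefl: "x \<in> M \<union> W \<Longrightarrow> (a, a) \<notin> R x"
  using asym by blast

lemma trans: "x \<in> M \<union> W \<Longrightarrow> (a, b) \<in> R x \<Longrightarrow> (b, c) \<in> R x \<Longrightarrow> (a, c) \<in> R x"
  using profile unfolding preference_profile_def strict_linear_order_on_def trans_def by blast

lemma total_M: "m \<in> M \<Longrightarrow> a \<in> W \<Longrightarrow> b \<in> W \<Longrightarrow> a = b \<or> (a, b) \<in> R m \<or> (b, a) \<in> R m"
  using profile unfolding preference_profile_def strict_linear_order_on_def total_on_def by blast

lemma total_W: "w \<in> W \<Longrightarrow> a \<in> M \<Longrightarrow> b \<in> M \<Longrightarrow> a = b \<or> (a, b) \<in> R w \<or> (b, a) \<in> R w"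
  using profile unfolding preference_profile_def strict_linear_order_on_def total_on_def by blast

lemma mu_M: "m \<in> M \<Longrightarrow> \<mu> m \<in> W" and mu_W: "w \<in> W \<Longrightarrow> \<mu> w \<in> M"
  and mu_mu: "x \<in> M \<union> W \<Longrightarrow> \<mu> (\<mu> x) = x"
  using matching unfolding matching_def by auto

text \<open>By totality, a woman who does not weakly prefer her partner to \<open>m\<close> is an
  admirer of \<open>m\<close>. The partner \<open>\<mu> m\<close> is never an admirer of
  \<open>m\<close>, so the weak preference of \<open>m\<close> becomes strict.\<close>

lemma stable_matching_iff:
  "stable_matching M W R \<mu> \<longleftrightarrow> (\<forall>m\<in>M. \<forall>w. admirer m w \<longrightarrow> (\<mu> m, w) \<in> R m)"
proof
  assume st: "stable_matching M W R \<mu>"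
  show "\<forall>m\<in>M. \<forall>w. admirer m w \<longrightarrow> (\<mu> m, w) \<in> R m"
  proof (intro ballI allI impI)
    fix m w assume m: "m \<in> M" and "admirer m w"
    then have w: "w \<in> W" "(m, \<mu> w) \<in> R w" by (auto simp: admirer_def)
    then have "\<not> weakly_prefers R w (\<mu> w) m"
      using asym[of w] irrefl[of w] unfolding weakly_prefers_def by auto
    then have "weakly_prefers R m (\<mu> m) w" using st m w unfolding stable_matching_def by blast
    moreover have "\<mu> m \<noteq> w" using w m irrefl[of w] mu_mu[of m] by auto
    ultimately show "(\<mu> m, w) \<in> R m" by (auto simp: weakly_prefers_def)
  qed
next
  assume st: "\<forall>m\<in>M. \<forall>w. admirer m w \<longrightarrow> (\<mu> m, w) \<in> R m"
  show "stable_matching M W R \<mu>"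
    unfolding stable_matching_def
  proof (intro conjI ballI matching)
    fix m w assume "m \<in> M" "w \<in> W"
    then show "weakly_prefers R m (\<mu> m) w \<or> weakly_prefers R w (\<mu> w) m"
      using st total_W[of w m "\<mu> w"] mu_W[of w] unfolding weakly_prefers_def admirer_def by metis
  qed
qed

lemma top_admirer_unique:
  "m \<in> M \<Longrightarrow> top_admirer m v \<Longrightarrow> top_admirer m w \<Longrightarrow> v = w"
  using asym[of m v w] unfolding top_admirer_def by blast

lemma top_admirer_exists:
  assumes m: "m \<in> M" and "admirer m v"
  obtains w where "top_admirer m w" "w = v \<or> (w, v) \<in> R m"
proof -
  let ?A = "{w. admirer m w}"
  have A: "finite ?A" "?A \<subseteq> W" using fin by (auto simp: admirer_def intro: finite_subset)
  \<comment> \<open>Stated for every finite nonempty \<open>B\<close> of women, because the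
    induction passes through subsets of the set of admirers.\<close>
  have "\<exists>w\<in>B. \<forall>u\<in>B. u = w \<or> (w, u) \<in> R m" if "finite B" "B \<noteq> {}" "B \<subseteq> W" for B
    using that
  proof (induction rule: finite_ne_induct)
    case (insert x F)
    then obtain w where w: "w \<in> F" "\<forall>u\<in>F. u = w \<or> (w, u) \<in> R m" by auto
    show ?case
    proof (cases "(w, x) \<in> R m")
      case False
      then have "(x, w) \<in> R m" using total_M[OF m, of x w] w insert by auto
      then show ?thesis using w trans[of m x w] m by (intro bexI[of _ x]) auto
    qed (use w in auto)
  qed auto
  from this[OF A(1) _ A(2)] assms(2) obtain w where "top_admirer m w"
    unfolding top_admirer_def by blast
  then show thesis using that assms(2) unfolding top_admirer_def by blast
qed

section \<open>Stable permutations extending the matching\<close>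

lemma extensionsD:
  assumes "\<sigma> \<in> extensions"
  shows "\<sigma> permutes M \<union> W" "m \<in> M \<Longrightarrow> \<sigma> m = \<mu> m" "w \<in> W \<Longrightarrow> \<sigma> w \<in> M"
    "m \<in> M \<Longrightarrow> inv \<sigma> m \<in> W" "w \<in> W \<Longrightarrow> inv \<sigma> w = \<mu> w" "\<sigma> (inv \<sigma> x) = x" "inv \<sigma> (\<sigma> x) = x"
proof -
  show p: "\<sigma> permutes M \<union> W" and M: "\<And>m. m \<in> M \<Longrightarrow> \<sigma> m = \<mu> m" and W: "\<And>w. w \<in> W \<Longrightarrow> \<sigma> w \<in> M"
    using assms by (auto simp: extensions_def bipartite_permutations_def)
  show i: "\<And>x. \<sigma> (inv \<sigma> x) = x" "\<And>x. inv \<sigma> (\<sigma> x) = x"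
    using permutes_inverses[OF p] by auto
  \<comment> \<open>\<open>\<sigma>\<close> agrees with \<open>\<mu>\<close> at the man
    \<open>\<mu> w\<close>, whose image is therefore \<open>w\<close>. So extensions differ only in
    where they send women.\<close>
  show "inv \<sigma> w = \<mu> w" if "w \<in> W" for w
    using M[of "\<mu> w"] mu_W mu_mu that i(2)[of "\<mu> w"] by auto
  show "inv \<sigma> m \<in> W" if "m \<in> M" for m
  proof -
    have "inv \<sigma> m \<in> M \<union> W" using that permutes_in_image[OF permutes_inv[OF p]] by auto
    moreover have "inv \<sigma> m \<notin> M" using M[of "inv \<sigma> m"] i(1)[of m] mu_M[of "inv \<sigma> m"] that disj by auto
    ultimately show ?thesis by auto
  qed
qed

text \<open>Since \<open>inv \<sigma>\<close> is \<open>\<mu>\<close> on women, the absence of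
  blocking pairs says that no admirer of \<open>m\<close> is better for \<open>m\<close> than
  \<open>inv \<sigma> m\<close>. The weak preferences of the men then yield stability of
  \<open>\<mu>\<close> by transitivity, and those of the women say that \<open>w\<close> is matched
  to \<open>\<sigma> w\<close> by \<open>\<mu>\<close> or admires him.\<close>

lemma stable_permutation_iff:
  assumes \<sigma>: "\<sigma> \<in> extensions"
  shows "stable_permutation M W R \<sigma> \<longleftrightarrow>
    stable_matching M W R \<mu> \<and> (\<forall>w\<in>W. \<sigma> w = \<mu> w \<or> top_admirer (\<sigma> w) w)"
proof
  note \<sigma> = extensionsD[OF \<sigma>]
  assume st: "stable_permutation M W R \<sigma>"
  have wp: "weakly_prefers R m (\<mu> m) (inv \<sigma> m)" if "m \<in> M" for m
    using st that \<sigma>(2) unfolding stable_permutation_def by (metis UnI1)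
  have ww: "weakly_prefers R w (\<sigma> w) (\<mu> w)" if "w \<in> W" for w
    using st that \<sigma>(5) unfolding stable_permutation_def by (metis UnI2)
  have nb: "v = inv \<sigma> m \<or> (inv \<sigma> m, v) \<in> R m" if "m \<in> M" "admirer m v" for m v
    using st that \<sigma>(4,5) total_M[of m v "inv \<sigma> m"] unfolding stable_permutation_def admirer_def
    by metis
  have "stable_matching M W R \<mu>"
    unfolding stable_matching_iff
  proof (intro ballI allI impI)
    fix m v assume m: "m \<in> M" and v: "admirer m v"
    have "v \<noteq> \<mu> m" using v m mu_mu[of m] irrefl[of v m] by (auto simp: admirer_def)
    then show "(\<mu> m, v) \<in> R m"
      using wp[OF m] nb[OF m v] trans[of m "\<mu> m"] m unfolding weakly_prefers_def by auto
  qed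
  \<comment> \<open>If \<open>\<sigma> w\<close> differs from \<open>\<mu> w\<close>, then
    \<open>w\<close> admires \<open>\<sigma> w\<close>, and \<open>nb\<close> at the man
    \<open>\<sigma> w\<close> compares her with his other admirers.\<close>
  moreover have "\<sigma> w = \<mu> w \<or> top_admirer (\<sigma> w) w" if "w \<in> W" for w
    using ww[OF that] nb[OF \<sigma>(3)[OF that]] that \<sigma>(7)[of w]
    unfolding top_admirer_def admirer_def weakly_prefers_def by metis
  ultimately show "stable_matching M W R \<mu> \<and> (\<forall>w\<in>W. \<sigma> w = \<mu> w \<or> top_admirer (\<sigma> w) w)"
    by blast
next
  note \<sigma> = extensionsD[OF \<sigma>]
  assume "stable_matching M W R \<mu> \<and> (\<forall>w\<in>W. \<sigma> w = \<mu> w \<or> top_admirer (\<sigma> w) w)"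
  then have st: "\<And>m v. m \<in> M \<Longrightarrow> admirer m v \<Longrightarrow> (\<mu> m, v) \<in> R m"
    and top: "\<And>w. w \<in> W \<Longrightarrow> \<sigma> w = \<mu> w \<or> top_admirer (\<sigma> w) w"
    unfolding stable_matching_iff by auto
  \<comment> \<open>The same dichotomy seen from the man: apply \<open>top\<close> to the woman
    \<open>inv \<sigma> m\<close>.\<close>
  have top': "inv \<sigma> m = \<mu> m \<or> top_admirer m (inv \<sigma> m)" if "m \<in> M" for m
    using top[OF \<sigma>(4)[OF that]] \<sigma>(6)[of m] mu_mu[of "inv \<sigma> m"] \<sigma>(4)[OF that] by auto
  show "stable_permutation M W R \<sigma>"
    unfolding stable_permutation_def
  proof (intro conjI ballI notI)
    fix x assume "x \<in> M \<union> W"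
    then show "weakly_prefers R x (\<sigma> x) (inv \<sigma> x)"
    proof
      assume x: "x \<in> M"
      show ?thesis
        using top'[OF x] st[OF x] \<sigma>(2)[OF x] unfolding weakly_prefers_def top_admirer_def by metis
    next
      assume x: "x \<in> W"
      show ?thesis
        using top[OF x] \<sigma>(5)[OF x] unfolding weakly_prefers_def top_admirer_def admirer_def by metis
    qed
  next
    assume "\<exists>m\<in>M. \<exists>w\<in>W. (w, inv \<sigma> m) \<in> R m \<and> (m, inv \<sigma> w) \<in> R w"
    then obtain m w where mw: "m \<in> M" "w \<in> W" "(w, inv \<sigma> m) \<in> R m" "(m, \<mu> w) \<in> R w"
      using \<sigma>(5) by metis
    then have "admirer m w" by (simp add: admirer_def)
    then show False
      using top'[OF mw(1)] st[OF mw(1), of w] mw asym[of m w "inv \<sigma> m"] irrefl[of m w]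
      unfolding top_admirer_def by auto
  qed
qed

section \<open>The women-optimal case\<close>

text \<open>Extensions are the identity outside \<open>M \<union> W\<close>, where
  \<open>\<mu>\<close> may take any value; this is \<open>\<mu>\<close> corrected there.\<close>

definition mu_perm :: "'a \<Rightarrow> 'a" where
  "mu_perm x = (if x \<in> M \<union> W then \<mu> x else x)"

lemma mu_perm_permutes: "mu_perm permutes M \<union> W"
proof (rule bij_imp_permutes)
  show "bij_betw mu_perm (M \<union> W) (M \<union> W)"
    by (rule bij_betw_byWitness[where f' = mu_perm])
      (auto simp: mu_perm_def mu_mu mu_M mu_W)
qed (simp add: mu_perm_def)

lemma mu_perm_extension: "mu_perm \<in> extensions"
  using mu_perm_permutes
  by (auto simp: extensions_def bipartite_permutations_def mu_perm_def mu_M mu_W)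

lemma extension_eq_mu_perm:
  assumes "\<sigma> \<in> extensions" "\<And>w. w \<in> W \<Longrightarrow> \<sigma> w = \<mu> w"
  shows "\<sigma> = mu_perm"
proof
  fix x show "\<sigma> x = mu_perm x"
    using assms(2) extensionsD(2)[OF assms(1)] permutes_not_in[OF extensionsD(1)[OF assms(1)]]
    by (auto simp: mu_perm_def)
qed

lemma num_long_cycles_mu_perm: "num_long_cycles M W mu_perm = 0"
proof -
  have "card (orbit mu_perm x) \<le> 2" if "x \<in> M \<union> W" for x
  proof -
    have "mu_perm (mu_perm x) = x"
      using that mu_mu[OF that] mu_M mu_W by (auto simp: mu_perm_def)
    then have "card (orbit mu_perm x) \<le> card {x, mu_perm x}"
      by (intro card_mono orbit_involution_subset) auto
    also have "\<dots> \<le> 2" by (simp add: card_insert_if)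
    finally show ?thesis .
  qed
  then have "{c \<in> orbit mu_perm ` (M \<union> W). card c > 2} = {}" by fastforce
  then show ?thesis unfolding num_long_cycles_def by (metis card.empty)
qed

text \<open>Matching every woman \<open>w\<close> to \<open>\<sigma> w\<close> gives a stable
  matching in which no woman is worse off than in \<open>\<mu>\<close>. Optimality of
  \<open>\<mu>\<close> then forces \<open>\<sigma> w = \<mu> w\<close>.\<close>

lemma stable_extension_women_optimal:
  assumes \<sigma>: "\<sigma> \<in> extensions" "stable_permutation M W R \<sigma>" and opt: "women_optimal M W R \<mu>"
  shows "\<sigma> = mu_perm"
proof (rule extension_eq_mu_perm[OF \<sigma>(1)])
  note s = extensionsD[OF \<sigma>(1)]
  have st: "\<And>m v. m \<in> M \<Longrightarrow> admirer m v \<Longrightarrow> (\<mu> m, v) \<in> R m"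
    and top: "\<And>w. w \<in> W \<Longrightarrow> \<sigma> w = \<mu> w \<or> top_admirer (\<sigma> w) w"
    using \<sigma>(2) unfolding stable_permutation_iff[OF \<sigma>(1)] stable_matching_iff by auto
  define \<nu> where "\<nu> x = (if x \<in> W then \<sigma> x else inv \<sigma> x)" for x
  have \<nu>W: "\<nu> w = \<sigma> w" if "w \<in> W" for w using that by (simp add: \<nu>_def)
  have \<nu>M: "\<nu> m = inv \<sigma> m" if "m \<in> M" for m using that disj by (auto simp: \<nu>_def)
  have "stable_matching M W R \<nu>"
    unfolding stable_matching_def
  proof (intro conjI ballI)
    show "matching M W \<nu>"
      unfolding matching_def using s(3,4,6,7) \<nu>M \<nu>W by (auto simp: image_subset_iff)
  next
    fix m w assume m: "m \<in> M" and w: "w \<in> W"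
    show "weakly_prefers R m (\<nu> m) w \<or> weakly_prefers R w (\<nu> w) m"
    proof (rule ccontr)
      assume "\<not> ?thesis"
      then have 1: "(w, inv \<sigma> m) \<in> R m" "(m, \<sigma> w) \<in> R w"
        using total_M[OF m w s(4)[OF m]] total_W[OF w m s(3)[OF w]] \<nu>M[OF m] \<nu>W[OF w]
        unfolding weakly_prefers_def by auto
      \<comment> \<open>A woman blocking with \<open>m\<close> is in particular an admirer of
        \<open>m\<close>; but \<open>inv \<sigma> m\<close> is his best admirer or
        \<open>\<mu> m\<close>, whom he prefers to all admirers.\<close>
      have "(m, \<mu> w) \<in> R w"
        using 1(2) top[OF w] trans[of w m "\<sigma> w" "\<mu> w"] w unfolding top_admirer_def admirer_def by auto
      then have a: "admirer m w" using w by (simp add: admirer_def)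
      have "inv \<sigma> m = \<mu> m \<or> top_admirer m (inv \<sigma> m)"
        using top[OF s(4)[OF m]] s(6)[of m] mu_mu[of "inv \<sigma> m"] s(4)[OF m] by auto
      then show False
        using a st[OF m a] 1(1) asym[of m w "inv \<sigma> m"] irrefl[of m w] m
        unfolding top_admirer_def by auto
    qed
  qed
  then have "weakly_prefers R w (\<mu> w) (\<sigma> w)" if "w \<in> W" for w
    using opt \<nu>W that unfolding women_optimal_def by metis
  then show "\<sigma> w = \<mu> w" if "w \<in> W" for w
    using top[OF that] asym[of w "\<mu> w" "\<sigma> w"] that
    unfolding weakly_prefers_def top_admirer_def admirer_def by fastforce
qed

section \<open>A cycle of best admirers when women-optimality fails\<close>

text \<open>Compare \<open>\<mu>\<close> with a stable matching \<open>\<nu>\<close> that some woman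
  strictly prefers. The set \<open>X\<close> consists of the men who prefer \<open>\<mu>\<close>,
  and \<open>Y\<close> of the women who prefer \<open>\<nu>\<close>; both matchings pair
  \<open>X\<close> with \<open>Y\<close>, and the best admirer of a man in \<open>X\<close> lies in
  \<open>Y\<close>.\<close>

lemma top_admirer_invariant_set:
  assumes st: "stable_matching M W R \<mu>" and not_opt: "\<not> women_optimal M W R \<mu>"
  obtains X where "X \<subseteq> M" "X \<noteq> {}" "\<And>m. m \<in> X \<Longrightarrow> \<exists>w. top_admirer m w \<and> \<mu> w \<in> X"
proof -
  obtain \<nu> w\<^sub>0 where \<nu>: "stable_matching M W R \<nu>" and w\<^sub>0: "w\<^sub>0 \<in> W" "\<not> weakly_prefers R w\<^sub>0 (\<mu> w\<^sub>0) (\<nu> w\<^sub>0)"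
    using not_opt unfolding women_optimal_def by blast
  have st': "\<And>m v. m \<in> M \<Longrightarrow> admirer m v \<Longrightarrow> (\<mu> m, v) \<in> R m"
    using st unfolding stable_matching_iff by auto
  have \<nu>M: "\<nu> m \<in> W" if "m \<in> M" for m using \<nu> that unfolding stable_matching_def matching_def by auto
  have \<nu>W: "\<nu> w \<in> M" if "w \<in> W" for w using \<nu> that unfolding stable_matching_def matching_def by auto
  have \<nu>\<nu>: "\<nu> (\<nu> x) = x" if "x \<in> M \<union> W" for x
    using \<nu> that unfolding stable_matching_def matching_def by auto
  have \<nu>st: "weakly_prefers R m (\<nu> m) w \<or> weakly_prefers R w (\<nu> w) m" if "m \<in> M" "w \<in> W" for m w
    using \<nu> that unfolding stable_matching_def by auto
  define X where "X = {m \<in> M. (\<mu> m, \<nu> m) \<in> R m}"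
  define Y where "Y = {w \<in> W. (\<nu> w, \<mu> w) \<in> R w}"
  have fin': "finite X" "finite Y" using fin by (auto simp: X_def Y_def)
  have YX: "\<nu> ` Y \<subseteq> X"
  proof
    fix m assume "m \<in> \<nu> ` Y"
    then obtain w where w: "w \<in> Y" "m = \<nu> w" by auto
    then have "w \<in> W" "admirer m w" by (auto simp: Y_def admirer_def)
    then show "m \<in> X" using st'[of m w] w \<nu>W[of w] \<nu>\<nu>[of w] by (auto simp: X_def)
  qed
  have XY: "\<mu> ` X \<subseteq> Y"
  proof
    fix w assume "w \<in> \<mu> ` X"
    then obtain m where m: "m \<in> M" "(\<mu> m, \<nu> m) \<in> R m" "w = \<mu> m" by (auto simp: X_def)
    have w: "w \<in> W" "\<mu> w = m" using m mu_M mu_mu by auto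
    have "\<not> weakly_prefers R m (\<nu> m) w"
      using m asym[of m] irrefl[of m] unfolding weakly_prefers_def by auto
    then have "weakly_prefers R w (\<nu> w) m" using \<nu>st[OF m(1) w(1)] by auto
    moreover have "\<nu> w \<noteq> m" using m w irrefl[of m] \<nu>\<nu>[of w] by auto
    ultimately show "w \<in> Y" using w by (auto simp: Y_def weakly_prefers_def)
  qed
  have inj: "inj_on \<nu> Y" "inj_on \<mu> X"
    using \<nu>\<nu> mu_mu by (metis (no_types, lifting) inj_onI X_def Y_def UnCI mem_Collect_eq)+
  \<comment> \<open>Stability of \<open>\<mu>\<close> gives an injection from \<open>Y\<close> to
    \<open>X\<close>, stability of \<open>\<nu>\<close> one from \<open>X\<close> to
    \<open>Y\<close>; by finiteness both are bijections.\<close>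
  have card: "card X = card Y"
    using card_inj_on_le[OF inj(1) YX fin'(1)] card_inj_on_le[OF inj(2) XY fin'(2)] by simp
  have img: "\<nu> ` Y = X" "\<mu> ` X = Y"
    using card card_image[OF inj(1)] card_image[OF inj(2)] card_subset_eq[OF fin'(1) YX] card_subset_eq[OF fin'(2) XY]
    by auto
  show thesis
  proof (rule that)
    show "X \<subseteq> M" by (auto simp: X_def)
    have "w\<^sub>0 \<in> Y"
      using w\<^sub>0 total_W[of w\<^sub>0 "\<mu> w\<^sub>0" "\<nu> w\<^sub>0"] mu_W \<nu>W by (auto simp: Y_def weakly_prefers_def)
    then show "X \<noteq> {}" using img by auto
  next
    fix m assume m: "m \<in> X"
    then obtain y where y: "y \<in> Y" "m = \<nu> y" using img by auto
    then have y': "y = \<nu> m" "y \<in> W" using \<nu>\<nu>[of y] by (auto simp: Y_def)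
    have mM: "m \<in> M" using m by (auto simp: X_def)
    have "admirer m y" using y by (auto simp: Y_def admirer_def)
    then obtain w where w: "top_admirer m w" "w = y \<or> (w, y) \<in> R m"
      by (rule top_admirer_exists[OF mM])
    have wW: "w \<in> W" "(m, \<mu> w) \<in> R w" using w by (auto simp: top_admirer_def admirer_def)
    \<comment> \<open>If \<open>w\<close> is not \<open>\<nu> m\<close>, then \<open>m\<close>
      prefers \<open>w\<close> to \<open>\<nu> m\<close>. Stability of \<open>\<nu>\<close> makes
      \<open>\<nu> w\<close> at least as good for \<open>w\<close> as \<open>m\<close>, who already
      beats \<open>\<mu> w\<close>.\<close>
    have "w \<in> Y"
    proof (cases "w = y")
      case False
      then have "\<not> weakly_prefers R m (\<nu> m) w"
        using w(2) y' asym[of m w y] mM by (auto simp: weakly_prefers_def)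
      then have "weakly_prefers R w (\<nu> w) m" using \<nu>st[OF mM wW(1)] by auto
      then show ?thesis using wW trans[of w "\<nu> w" m "\<mu> w"] by (auto simp: Y_def weakly_prefers_def)
    qed (use y in auto)
    then obtain x where "x \<in> X" "w = \<mu> x" using img by auto
    then have "\<mu> w \<in> X" using mu_mu[of x] by (auto simp: X_def)
    then show "\<exists>w. top_admirer m w \<and> \<mu> w \<in> X" using w by auto
  qed
qed

text \<open>Choosing best admirers and passing to their partners maps the finite set
  \<open>X\<close> into itself; \<open>K\<close> is the orbit of a periodic point. This is a
  rotation exposed at \<open>\<mu>\<close> in the usual sense of stable matching theory.\<close>

lemma rotation_exists:
  assumes "stable_matching M W R \<mu>" "\<not> women_optimal M W R \<mu>"
  obtains s K where "K \<subseteq> M" "\<And>m. m \<in> K \<Longrightarrow> top_admirer m (s m)" "cyclic_on (\<lambda>m. \<mu> (s m)) K"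
proof -
  obtain X where X: "X \<subseteq> M" "X \<noteq> {}" "\<And>m. m \<in> X \<Longrightarrow> \<exists>w. top_admirer m w \<and> \<mu> w \<in> X"
    using top_admirer_invariant_set[OF assms] by metis
  then obtain s where s: "\<And>m. m \<in> X \<Longrightarrow> top_admirer m (s m) \<and> \<mu> (s m) \<in> X" by metis
  let ?g = "\<lambda>m. \<mu> (s m)"
  obtain x where x: "x \<in> X" "x \<in> orbit ?g x"
    by (rule periodic_point_exists[of X ?g]) (use X(1,2) s finite_subset[OF X(1) fin(1)] in auto)
  have "orbit ?g x \<subseteq> X"
  proof
    fix y assume "y \<in> orbit ?g x"
    then show "y \<in> X" by induction (use x s in auto)
  qed
  then show thesis
    using that[of "orbit ?g x" s] X(1) s x by (auto simp: cyclic_on_def)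
qed

end

section \<open>The permutation that rotates along the cycle\<close>

text \<open>
  The fixed cycle is \<open>K\<close>, and \<open>rotate\<close> is the stable permutation whose only long cycle lies over it.
\<close>

locale rotation = market +
  fixes s :: "'a \<Rightarrow> 'a" and K :: "'a set"
  assumes stable: "stable_matching M W R \<mu>"
    and K: "K \<subseteq> M" and s: "\<And>m. m \<in> K \<Longrightarrow> top_admirer m (s m)"
    and cyclic: "cyclic_on (\<lambda>m. \<mu> (s m)) K"
begin

abbreviation g :: "'a \<Rightarrow> 'a" where "g m \<equiv> \<mu> (s m)"

definition cycle_agents :: "'a set" where "cycle_agents = K \<union> s ` K"

definition rotate :: "'a \<Rightarrow> 'a" where
  "rotate x = (if x \<in> s ` K then the_inv_into K s x else mu_perm x)"

lemma s_W: "m \<in> K \<Longrightarrow> s m \<in> W"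
  using s unfolding top_admirer_def admirer_def by blast

lemma g_K: "m \<in> K \<Longrightarrow> g m \<in> K"
  using cyclic by (rule cyclic_on_inI)

lemma mu_g: "m \<in> K \<Longrightarrow> \<mu> (g m) = s m"
  using s_W mu_mu by auto

lemma g_image: "g ` K = K"
proof
  show "g ` K \<subseteq> K" using g_K by auto
  show "K \<subseteq> g ` K"
  proof
    fix m assume "m \<in> K"
    then have "m \<in> orbit g m" "orbit g m = K" using cyclic unfolding cyclic_on_alldef by auto
    then show "m \<in> g ` K" using \<open>m \<in> K\<close> by (cases rule: orbit.cases) blast+
  qed
qed

text \<open>Each \<open>s m\<close> is the partner of \<open>g m\<close>, and \<open>g\<close>
  permutes \<open>K\<close>. So \<open>cycle_agents\<close> is closed under \<open>\<mu>\<close>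
  too.\<close>

lemma s_image: "s ` K = \<mu> ` K"
proof -
  have "s ` K = (\<lambda>m. \<mu> (g m)) ` K" using mu_g by (intro image_cong) auto
  also have "\<dots> = \<mu> ` g ` K" by (rule image_image[symmetric])
  finally show ?thesis by (simp only: g_image)
qed

lemma inj_s: "inj_on s K"
proof -
  have "inj_on g K"
    using finite_subset[OF K fin(1)] by (rule eq_card_imp_inj_on) (simp add: g_image)
  then show ?thesis by (auto simp: inj_on_def)
qed

text \<open>\<open>s m\<close> strictly prefers \<open>m\<close> to her partner \<open>g m\<close>.
  This makes the cycle of \<open>rotate\<close> long and separates \<open>rotate\<close> from
  \<open>mu_perm\<close>.\<close>

lemma g_neq: "m \<in> K \<Longrightarrow> g m \<noteq> m"
  using s[of m] irrefl[of "s m" m] unfolding top_admirer_def admirer_def by auto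

lemma rotate_s: "m \<in> K \<Longrightarrow> rotate (s m) = m"
  by (simp add: rotate_def the_inv_into_f_f[OF inj_s])

lemma rotate_M: "m \<in> M \<Longrightarrow> rotate m = \<mu> m"
  using s_W disj by (auto simp: rotate_def mu_perm_def)

lemma cycle_agents_subset: "cycle_agents \<subseteq> M \<union> W"
  using K s_W by (auto simp: cycle_agents_def)

lemma rotate_image: "rotate ` cycle_agents = cycle_agents" and mu_perm_image: "mu_perm ` cycle_agents = cycle_agents"
proof -
  have "rotate ` K = s ` K" unfolding s_image using rotate_M K by (intro image_cong) auto
  moreover have "rotate ` s ` K = K" using rotate_s by (auto simp: image_image)
  ultimately show "rotate ` cycle_agents = cycle_agents" by (auto simp: cycle_agents_def image_Un)
  have "mu_perm ` K = \<mu> ` K" using K by (auto simp: mu_perm_def)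
  moreover have "mu_perm ` s ` K = g ` K" using s_W by (auto simp: mu_perm_def image_image)
  ultimately show "mu_perm ` cycle_agents = cycle_agents" unfolding cycle_agents_def image_Un g_image s_image by auto
qed

text \<open>All or nothing: once \<open>\<sigma>\<close> sends \<open>s m\<close> to
  \<open>m\<close> for one \<open>m\<close> in \<open>K\<close>, this choice propagates around the
  whole cycle.\<close>

lemma extension_cases:
  assumes \<sigma>: "\<sigma> \<in> extensions" "stable_permutation M W R \<sigma>"
  shows "(\<forall>x\<in>cycle_agents. \<sigma> x = rotate x) \<or> (\<forall>x\<in>cycle_agents. \<sigma> x = mu_perm x)"
proof -
  note e = extensionsD[OF \<sigma>(1)]
  have dich: "\<sigma> (\<mu> m) = m \<or> \<sigma> (s m) = m" if m: "m \<in> K" for m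
  proof -
    have mM: "m \<in> M" using m K by auto
    have w: "inv \<sigma> m \<in> W" using e(4) mM .
    then consider "m = \<mu> (inv \<sigma> m)" | "top_admirer m (inv \<sigma> m)"
      using \<sigma>(2) e(6)[of m] unfolding stable_permutation_iff[OF \<sigma>(1)] by metis
    then show ?thesis
    proof cases
      case 1
      then show ?thesis using mu_mu[of "inv \<sigma> m"] w e(6) by (metis UnI2)
    next
      case 2
      then show ?thesis using top_admirer_unique[OF mM 2 s[OF m]] e(6) by metis
    qed
  qed
  show ?thesis
  proof (cases "\<exists>m\<in>K. \<sigma> (s m) = m")
    case True
    then obtain m where m: "m \<in> K" "\<sigma> (s m) = m" by auto
    \<comment> \<open>The woman \<open>s a\<close> is \<open>\<mu> (g a)\<close> and is already sent
      to \<open>a\<close>, which is not \<open>g a\<close>; so \<open>g a\<close> must take the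
      other alternative of \<open>dich\<close>.\<close>
    have step: "\<sigma> (s (g a)) = g a" if "a \<in> K" "\<sigma> (s a) = a" for a
      using dich[OF g_K[OF that(1)]] g_neq[OF that(1)] that mu_g[OF that(1)] by auto
    have "\<sigma> (s a) = a" if "a \<in> orbit g m" for a
    proof -
      have "a \<in> K \<and> \<sigma> (s a) = a" using that
        by induction (use m step g_K in auto)
      then show ?thesis ..
    qed
    moreover have "orbit g m = K" using cyclic m orbit_cyclic_eq3 by metis
    ultimately have "\<forall>x\<in>cycle_agents. \<sigma> x = rotate x"
      using rotate_s rotate_M e(2) K by (auto simp: cycle_agents_def)
    then show ?thesis ..
  next
    case False
    then have "\<sigma> (\<mu> m) = m" if "m \<in> K" for m using dich that by auto
    then have "\<sigma> (s m) = g m" if "m \<in> K" for m using g_K[OF that] mu_g[OF that] by metis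
    then have "\<forall>x\<in>cycle_agents. \<sigma> x = mu_perm x"
      using e(2) K s_W by (auto simp: cycle_agents_def mu_perm_def)
    then show ?thesis ..
  qed
qed

lemma rotate_neq_mu_perm: "\<not> (\<forall>x\<in>cycle_agents. rotate x = mu_perm x)"
proof -
  obtain m where "m \<in> K" using cyclic unfolding cyclic_on_def by auto
  then have "s m \<in> cycle_agents" "rotate (s m) \<noteq> mu_perm (s m)"
    using rotate_s g_neq[of m] s_W by (auto simp: cycle_agents_def mu_perm_def)
  then show ?thesis by blast
qed

lemma cyclic_rotate: "cyclic_on rotate cycle_agents"
proof -
  have sub: "orbit rotate x \<subseteq> cycle_agents" if "x \<in> cycle_agents" for x
  proof
    fix y assume "y \<in> orbit rotate x"
    then show "y \<in> cycle_agents" by induction (use that rotate_image in auto)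
  qed
  have reach: "a \<in> orbit rotate b" if "b \<in> orbit g a" "a \<in> K" for a b
  proof -
    \<comment> \<open>\<open>rotate\<close> takes \<open>g c\<close> to
      \<open>\<mu> (g c) = s c\<close> and then to \<open>c\<close>: two of its steps undo one step
      of \<open>g\<close>. It thus runs through \<open>K\<close> backwards and visits the women in
      between.\<close>
    have step: "c \<in> orbit rotate (g c)" if "c \<in> K" for c
      using orbit.step[OF orbit.base[of rotate "g c"]] rotate_M[of "g c"] g_K[OF that] K mu_g[OF that]
        rotate_s[OF that] by auto
    have "b \<in> K \<and> a \<in> orbit rotate b" using that(1)
    proof induction
      case base
      then show ?case using step g_K that(2) by blast
    next
      case (step y)
      then show ?case using \<open>\<And>c. c \<in> K \<Longrightarrow> c \<in> orbit rotate (g c)\<close> g_K orbit_trans by metis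
    qed
    then show ?thesis ..
  qed
  have KK: "a \<in> orbit rotate b" if "a \<in> K" "b \<in> K" for a b
    using reach that cyclic orbit_cyclic_eq3 by metis
  obtain m where m: "m \<in> K" using cyclic unfolding cyclic_on_def by auto
  have "cycle_agents \<subseteq> orbit rotate m"
  proof
    fix x assume "x \<in> cycle_agents"
    then consider "x \<in> K" | a where "a \<in> K" "x = \<mu> a" using s_image by (auto simp: cycle_agents_def)
    then show "x \<in> orbit rotate m"
    proof cases
      case 2
      then show ?thesis using orbit.step[OF KK[OF 2(1) m]] rotate_M K by auto
    qed (use KK m in auto)
  qed
  moreover have "m \<in> cycle_agents" using m by (simp add: cycle_agents_def)
  ultimately show ?thesis using sub by (intro cyclic_on_singleI[of m]) auto
qed

lemma card_cycle_agents: "card cycle_agents > 2"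
proof -
  obtain m where m: "m \<in> K" using cyclic unfolding cyclic_on_def by auto
  have "finite cycle_agents" using cycle_agents_subset fin finite_subset by blast
  moreover have "{m, g m, s m} \<subseteq> cycle_agents" using m g_K by (auto simp: cycle_agents_def)
  ultimately have "card {m, g m, s m} \<le> card cycle_agents" by (rule card_mono)
  moreover have "card {m, g m, s m} = 3"
    using g_neq[OF m] s_W[OF m] K m g_K[OF m] disj by (auto simp: card_insert_if)
  ultimately show ?thesis by simp
qed

section \<open>Toggling the cycle\<close>

text \<open>On stable extensions the test decides between the two cases of
  \<open>extension_cases\<close>, which exclude each other by
  \<open>rotate_neq_mu_perm\<close>.\<close>

definition toggle :: "('a \<Rightarrow> 'a) \<Rightarrow> 'a \<Rightarrow> 'a" where
  "toggle \<sigma> x = (if x \<in> cycle_agents then if \<forall>y\<in>cycle_agents. \<sigma> y = mu_perm y then rotate x else mu_perm x else \<sigma> x)"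

lemma toggle_mu_perm:
  "(\<And>y. y \<in> cycle_agents \<Longrightarrow> \<sigma> y = mu_perm y) \<Longrightarrow> x \<in> cycle_agents \<Longrightarrow> toggle \<sigma> x = rotate x"
  by (auto simp: toggle_def)

lemma toggle_rotate:
  "(\<And>y. y \<in> cycle_agents \<Longrightarrow> \<sigma> y = rotate y) \<Longrightarrow> x \<in> cycle_agents \<Longrightarrow> toggle \<sigma> x = mu_perm x"
  using rotate_neq_mu_perm by (auto simp: toggle_def)

lemma toggle_outside: "x \<notin> cycle_agents \<Longrightarrow> toggle \<sigma> x = \<sigma> x"
  by (simp add: toggle_def)

lemma toggle_toggle:
  assumes "\<sigma> \<in> extensions" "stable_permutation M W R \<sigma>"
  shows "toggle (toggle \<sigma>) = \<sigma>"
proof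
  fix x
  show "toggle (toggle \<sigma>) x = \<sigma> x"
  proof (cases "x \<in> cycle_agents")
    case True
    from extension_cases[OF assms] show ?thesis
    proof
      assume *: "\<forall>x\<in>cycle_agents. \<sigma> x = rotate x"
      then have "toggle \<sigma> y = mu_perm y" if "y \<in> cycle_agents" for y using toggle_rotate that by blast
      then show ?thesis using toggle_mu_perm True * by simp
    next
      assume *: "\<forall>x\<in>cycle_agents. \<sigma> x = mu_perm x"
      then have "toggle \<sigma> y = rotate y" if "y \<in> cycle_agents" for y using toggle_mu_perm that by blast
      then show ?thesis using toggle_rotate True * by simp
    qed
  qed (simp add: toggle_outside)
qed

text \<open>Old and new values both map \<open>cycle_agents\<close> onto itself, so the exchange
  keeps a bijection. The criterion \<open>stable_permutation_iff\<close> is checked woman by woman,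
  and both values available at \<open>s m\<close>, namely \<open>m\<close> and
  \<open>\<mu> (s m)\<close>, satisfy it.\<close>

lemma toggle_extension:
  assumes \<sigma>: "\<sigma> \<in> extensions" "stable_permutation M W R \<sigma>"
  shows "toggle \<sigma> \<in> extensions" "stable_permutation M W R (toggle \<sigma>)"
proof -
  note e = extensionsD[OF \<sigma>(1)]
  have imO: "\<sigma> ` cycle_agents = cycle_agents \<and> toggle \<sigma> ` cycle_agents = cycle_agents"
    using extension_cases[OF \<sigma>]
  proof
    assume *: "\<forall>x\<in>cycle_agents. \<sigma> x = rotate x"
    then have "\<sigma> ` cycle_agents = rotate ` cycle_agents" by (intro image_cong) auto
    moreover have "toggle \<sigma> ` cycle_agents = mu_perm ` cycle_agents"
      using * by (intro image_cong toggle_rotate) auto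
    ultimately show ?thesis using rotate_image mu_perm_image by simp
  next
    assume *: "\<forall>x\<in>cycle_agents. \<sigma> x = mu_perm x"
    then have "\<sigma> ` cycle_agents = mu_perm ` cycle_agents" by (intro image_cong) auto
    moreover have "toggle \<sigma> ` cycle_agents = rotate ` cycle_agents"
      using * by (intro image_cong toggle_mu_perm) auto
    ultimately show ?thesis using rotate_image mu_perm_image by simp
  qed
  have "bij_betw \<sigma> (M \<union> W) (M \<union> W)" using e(1) by (rule permutes_imp_bij)
  then have "inj_on \<sigma> (M \<union> W)" "\<sigma> ` (M \<union> W) = M \<union> W" by (auto simp: bij_betw_def)
  then have imC: "\<sigma> ` (M \<union> W - cycle_agents) = M \<union> W - cycle_agents"
    using imO cycle_agents_subset by (simp add: inj_on_image_set_diff)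
  have "toggle \<sigma> ` (M \<union> W) = toggle \<sigma> ` cycle_agents \<union> toggle \<sigma> ` (M \<union> W - cycle_agents)"
    using cycle_agents_subset by blast
  also have "toggle \<sigma> ` (M \<union> W - cycle_agents) = \<sigma> ` (M \<union> W - cycle_agents)"
    by (intro image_cong) (auto simp: toggle_outside)
  finally have im: "toggle \<sigma> ` (M \<union> W) = M \<union> W" using imO imC cycle_agents_subset by auto
  have "toggle \<sigma> permutes M \<union> W"
  proof (rule bij_imp_permutes)
    show "bij_betw (toggle \<sigma>) (M \<union> W) (M \<union> W)"
      using im fin by (simp add: bij_betw_def eq_card_imp_inj_on)
    show "toggle \<sigma> x = x" if "x \<notin> M \<union> W" for x
      using that cycle_agents_subset toggle_outside permutes_not_in[OF e(1)] by (metis subsetD)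
  qed
  moreover have M: "toggle \<sigma> m = \<mu> m" if "m \<in> M" for m
    using that e(2) rotate_M by (auto simp: toggle_def mu_perm_def)
  moreover have W: "toggle \<sigma> w \<in> M \<and> (toggle \<sigma> w = \<mu> w \<or> top_admirer (toggle \<sigma> w) w)"
    if w: "w \<in> W" for w
  proof (cases "w \<in> cycle_agents")
    case True
    then obtain m where m: "m \<in> K" "w = s m" using w K disj by (auto simp: cycle_agents_def)
    have "toggle \<sigma> w = m \<or> toggle \<sigma> w = \<mu> w"
      using True m rotate_s w by (auto simp: toggle_def mu_perm_def)
    moreover have "m \<in> M" "top_admirer m w" using m s K by auto
    ultimately show ?thesis using mu_W[OF w] by metis
  next
    case False
    then show ?thesis
      using e(3) w \<sigma>(2) unfolding stable_permutation_iff[OF \<sigma>(1)] by (simp add: toggle_outside)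
  qed
  ultimately show *: "toggle \<sigma> \<in> extensions"
    by (auto simp: extensions_def bipartite_permutations_def mu_M)
  show "stable_permutation M W R (toggle \<sigma>)"
    unfolding stable_permutation_iff[OF *] using stable W by blast
qed

lemma num_long_cycles_rotate:
  assumes \<sigma>: "\<sigma> \<in> extensions" and \<tau>: "\<tau> \<in> extensions"
    and rot: "\<And>x. x \<in> cycle_agents \<Longrightarrow> \<sigma> x = rotate x" and mu: "\<And>x. x \<in> cycle_agents \<Longrightarrow> \<tau> x = mu_perm x"
    and eq: "\<And>x. x \<notin> cycle_agents \<Longrightarrow> \<sigma> x = \<tau> x"
  shows "num_long_cycles M W \<sigma> = Suc (num_long_cycles M W \<tau>)"
proof (rule num_long_cycles_merge)
  show "finite (M \<union> W)" using fin by simp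
  show "\<sigma> permutes M \<union> W" "\<tau> permutes M \<union> W" using extensionsD(1) \<sigma> \<tau> by auto
  show "cyclic_on \<sigma> cycle_agents" using cyclic_rotate rot cyclic_cong by metis
  show "\<tau> x \<in> cycle_agents \<and> \<tau> (\<tau> x) = x" if "x \<in> cycle_agents" for x
  proof -
    have "mu_perm x \<in> cycle_agents" using mu_perm_image that by blast
    moreover have "mu_perm (mu_perm x) = x"
      using that cycle_agents_subset mu_mu[of x] mu_M mu_W by (auto simp: mu_perm_def)
    ultimately show ?thesis using mu that by simp
  qed
qed (use cycle_agents_subset card_cycle_agents eq in auto)

lemma num_long_cycles_toggle:
  assumes \<sigma>: "\<sigma> \<in> extensions" "stable_permutation M W R \<sigma>"
  shows "(-1 :: real) ^ num_long_cycles M W (toggle \<sigma>) = - ((-1) ^ num_long_cycles M W \<sigma>)"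
  using extension_cases[OF \<sigma>]
proof
  assume *: "\<forall>x\<in>cycle_agents. \<sigma> x = rotate x"
  then have "num_long_cycles M W \<sigma> = Suc (num_long_cycles M W (toggle \<sigma>))"
    using toggle_rotate by (intro num_long_cycles_rotate \<sigma>(1) toggle_extension(1)[OF \<sigma>])
      (auto simp: toggle_outside)
  then show ?thesis by simp
next
  assume *: "\<forall>x\<in>cycle_agents. \<sigma> x = mu_perm x"
  then have "num_long_cycles M W (toggle \<sigma>) = Suc (num_long_cycles M W \<sigma>)"
    using toggle_mu_perm by (intro num_long_cycles_rotate \<sigma>(1) toggle_extension(1)[OF \<sigma>])
      (auto simp: toggle_outside)
  then show ?thesis by simp
qed

lemma sum_stable_extensions:
  "(\<Sum>\<sigma> | \<sigma> \<in> extensions \<and> stable_permutation M W R \<sigma>. (-1 :: real) ^ num_long_cycles M W \<sigma>) = 0"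
  by (rule sum_sign_reversing_involution[where T = toggle])
    (auto simp: toggle_toggle toggle_extension num_long_cycles_toggle)

end

section \<open>The identity for a single profile\<close>

context market
begin

lemma finite_extensions: "finite extensions"
  by (rule finite_subset[OF _ finite_permutations[of "M \<union> W"]])
    (use fin in \<open>auto simp: extensions_def bipartite_permutations_def\<close>)

lemma women_optimal_eq_sum:
  "(\<Sum>\<sigma>\<in>extensions. (-1 :: real) ^ num_long_cycles M W \<sigma> * of_bool (stable_permutation M W R \<sigma>)) =
    of_bool (stable_matching M W R \<mu> \<and> women_optimal M W R \<mu>)"
proof -
  let ?S = "{\<sigma>. \<sigma> \<in> extensions \<and> stable_permutation M W R \<sigma>}"
  have "(\<Sum>\<sigma>\<in>extensions. (-1 :: real) ^ num_long_cycles M W \<sigma> * of_bool (stable_permutation M W R \<sigma>)) =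
      (\<Sum>\<sigma>\<in>?S. (-1) ^ num_long_cycles M W \<sigma>)"
    by (rule sum.mono_neutral_cong_right[OF finite_extensions]) auto
  also have "\<dots> = of_bool (stable_matching M W R \<mu> \<and> women_optimal M W R \<mu>)"
  proof (cases "stable_matching M W R \<mu>")
    case False
    then have "?S = {}" using stable_permutation_iff by blast
    then have "(\<Sum>\<sigma>\<in>?S. (-1 :: real) ^ num_long_cycles M W \<sigma>) = 0" by (metis sum.empty)
    then show ?thesis using False by simp
  next
    case st: True
    show ?thesis
    proof (cases "women_optimal M W R \<mu>")
      case True
      have "stable_permutation M W R mu_perm"
        unfolding stable_permutation_iff[OF mu_perm_extension] using st by (simp add: mu_perm_def)
      then have "?S = {mu_perm}"
        using stable_extension_women_optimal[OF _ _ True] mu_perm_extension by blast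
      then have "(\<Sum>\<sigma>\<in>?S. (-1 :: real) ^ num_long_cycles M W \<sigma>) = 1"
        by (simp add: num_long_cycles_mu_perm)
      then show ?thesis using st True by simp
    next
      case False
      \<comment> \<open>The cycle depends on the profile, so the cancellation is obtained by
        interpreting \<open>rotation\<close> inside this case.\<close>
      obtain s K where "K \<subseteq> M" "\<And>m. m \<in> K \<Longrightarrow> top_admirer m (s m)" "cyclic_on (\<lambda>m. \<mu> (s m)) K"
        by (rule rotation_exists[OF st False]) (rule that)
      then interpret rotation M W R \<mu> s K
        using st by unfold_locales
      show ?thesis using sum_stable_extensions False by simp
    qed
  qed
  finally show ?thesis .
qed

end

section \<open>From single profiles to probabilities, and the exchange of men and women\<close>

text \<open>Linearity of expectation turns the identity for each profile into one for probabilities.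
  Keeping \<open>D\<close> general allows its reuse for the same distribution with \<open>M\<close>
  and \<open>W\<close> exchanged.\<close>

lemma prob_women_optimal_eq_sum:
  fixes D :: "'a profile pmf"
  assumes "finite M" "finite W" "M \<inter> W = {}" "matching M W \<mu>"
    and profile: "\<And>R. R \<in> set_pmf D \<Longrightarrow> preference_profile M W R"
  shows "measure_pmf.prob D {R. stable_matching M W R \<mu> \<and> women_optimal M W R \<mu>} =
    (\<Sum>\<sigma> | \<sigma> \<in> bipartite_permutations M W \<and> (\<forall>m\<in>M. \<sigma> m = \<mu> m).
      (-1) ^ num_long_cycles M W \<sigma> * measure_pmf.prob D {R. stable_permutation M W R \<sigma>})"
    (is "?L = sum ?f ?E")
proof -
  have prob: "measure_pmf.prob D {R. Q R} = measure_pmf.expectation D (\<lambda>R. of_bool (Q R))" for Q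
  proof -
    have "(\<lambda>R. of_bool (Q R) :: real) = indicator {R. Q R}" by (auto simp: indicator_def)
    then show ?thesis by simp
  qed
  have int: "integrable (measure_pmf D) (\<lambda>R. of_bool (Q R) :: real)" for Q
    by (rule measure_pmf.integrable_const_bound[where B = 1]) auto
  have "sum ?f ?E = measure_pmf.expectation D
      (\<lambda>R. \<Sum>\<sigma>\<in>?E. (-1) ^ num_long_cycles M W \<sigma> * of_bool (stable_permutation M W R \<sigma>))"
    unfolding prob by (simp only: Bochner_Integration.integral_sum integrable_mult_right int integral_mult_right_zero)
  also have "\<dots> = measure_pmf.expectation D
      (\<lambda>R. of_bool (stable_matching M W R \<mu> \<and> women_optimal M W R \<mu>))"
  \<comment> \<open>The integrands are compared only on the support of \<open>D\<close>, where
    \<open>R\<close> is a genuine preference profile.\<close>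
  proof (intro integral_cong_AE AE_pmfI)
    fix R assume "R \<in> set_pmf D"
    then interpret market M W R \<mu> using assms by unfold_locales auto
    show "(\<Sum>\<sigma>\<in>?E. (-1 :: real) ^ num_long_cycles M W \<sigma> * of_bool (stable_permutation M W R \<sigma>)) =
        of_bool (stable_matching M W R \<mu> \<and> women_optimal M W R \<mu>)"
      using women_optimal_eq_sum unfolding extensions_def .
  qed auto
  also have "\<dots> = ?L" by (rule prob[symmetric])
  finally show ?thesis by (rule sym)
qed

lemma stable_matching_swap: "stable_matching W M R \<mu> = stable_matching M W R \<mu>"
  unfolding stable_matching_def matching_def by (auto simp: Un_commute)

lemma stable_permutation_swap: "stable_permutation W M R \<sigma> = stable_permutation M W R \<sigma>"
  unfolding stable_permutation_def by (auto simp: Un_commute)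

theorem lemma5p3p1:
  fixes M W :: "'a set" and N :: nat and P :: "'a \<Rightarrow> 'a \<Rightarrow> real" and \<mu> :: "'a \<Rightarrow> 'a"
  assumes "finite M" "finite W" "M \<inter> W = {}" "card M = N" "card W = N"
    and "\<And>m w. m \<in> M \<Longrightarrow> w \<in> W \<Longrightarrow> P m w > 0"
    and "matching M W \<mu>"
  shows
    "(measure_pmf.prob (symmetric_anti_popularity_pmf M W P)
         {R. stable_matching M W R \<mu> \<and> women_optimal M W R \<mu>} =
       (\<Sum>\<sigma> | \<sigma> \<in> bipartite_permutations M W \<and> (\<forall>m\<in>M. \<sigma> m = \<mu> m).
          (-1) ^ num_long_cycles M W \<sigma> *
          measure_pmf.prob (symmetric_anti_popularity_pmf M W P) {R. stable_permutation M W R \<sigma>})) \<and>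
     (measure_pmf.prob (symmetric_anti_popularity_pmf M W P)
         {R. stable_matching M W R \<mu> \<and> men_optimal M W R \<mu>} =
       (\<Sum>\<sigma> | \<sigma> \<in> bipartite_permutations M W \<and> (\<forall>w\<in>W. \<sigma> w = \<mu> w).
          (-1) ^ num_long_cycles M W \<sigma> *
          measure_pmf.prob (symmetric_anti_popularity_pmf M W P) {R. stable_permutation M W R \<sigma>}))"
proof
  let ?D = "symmetric_anti_popularity_pmf M W P"
  have profile: "preference_profile M W R" if "R \<in> set_pmf ?D" for R
    using symmetric_anti_popularity_preference_profile[OF assms(1-3,6) that] .
  then have profile': "preference_profile W M R" if "R \<in> set_pmf ?D" for R
    using that unfolding preference_profile_def by blast
  show "measure_pmf.prob ?D {R. stable_matching M W R \<mu> \<and> women_optimal M W R \<mu>} =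
       (\<Sum>\<sigma> | \<sigma> \<in> bipartite_permutations M W \<and> (\<forall>m\<in>M. \<sigma> m = \<mu> m).
          (-1) ^ num_long_cycles M W \<sigma> * measure_pmf.prob ?D {R. stable_permutation M W R \<sigma>})"
    by (rule prob_women_optimal_eq_sum[OF assms(1-3,7) profile])
  \<comment> \<open>Women-optimality with the two sides exchanged is men-optimality, and stability,
    the permutations and the cycle count are symmetric in \<open>M\<close> and
    \<open>W\<close>.\<close>
  have "matching W M \<mu>" "W \<inter> M = {}" using assms(3,7) by (auto simp: matching_def)
  note swapped = prob_women_optimal_eq_sum[OF assms(2,1) this(2,1) profile']
  have "women_optimal W M R \<mu> = men_optimal M W R \<mu>" for R
    by (simp add: women_optimal_def men_optimal_def stable_matching_swap[of W M])
  moreover have "bipartite_permutations W M = bipartite_permutations M W"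
    by (auto simp: bipartite_permutations_def Un_commute)
  moreover have "num_long_cycles W M \<sigma> = num_long_cycles M W \<sigma>" for \<sigma>
    by (simp add: num_long_cycles_def Un_commute)
  ultimately show "measure_pmf.prob ?D {R. stable_matching M W R \<mu> \<and> men_optimal M W R \<mu>} =
       (\<Sum>\<sigma> | \<sigma> \<in> bipartite_permutations M W \<and> (\<forall>w\<in>W. \<sigma> w = \<mu> w).
          (-1) ^ num_long_cycles M W \<sigma> * measure_pmf.prob ?D {R. stable_permutation M W R \<sigma>})"
    using swapped by (simp only: stable_matching_swap[of W M] stable_permutation_swap[of W M])
qed

end
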